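(* For a Puiseux monoid $M$, the following conditions are equivalent. (1) $M$ is eventually dense. (2) $M$ is somewhere dense.
   Context: A Puiseux monoid is an additive submonoid of $(\mathbb{Q}_{\ge 0},+)$. For $A,B\subseteq\mathbb{R}$, $A$ is dense in $B$ if $A\cap B$ is a dense subset of $B$ with the Euclidean subspace topology. A Puiseux monoid $M$ is eventually dense if there exists $r\in\mathbb{R}_{\ge 0}$ such that $M$ is dense in $\mathbb{R}_{>r}=\{x\in\mathbb{R}\mid x>r\}$; it is somewhere dense if there exists a nonempty open interval $(r,s)\subseteq\mathbb{R}_{\ge 0}$ such that $M$ is dense in $(r,s)$. *)

theory Defs
  imports "HOL-Analysis.Analysis"
begin

definition puiseux_monoid :: "rat set \<Rightarrow> bool" where
  "puiseux_monoid M \<longleftrightarrow>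
     M \<subseteq> {0..} \<and> 0 \<in> M \<and> (\<forall>x\<in>M. \<forall>y\<in>M. x + y \<in> M)"

text \<open>\<open>A\<close> need not be contained in \<open>B\<close>; the closure is taken in the Euclidean subspace
  topology of \<open>B\<close>.\<close>

definition dense_in_set :: "real set \<Rightarrow> real set \<Rightarrow> bool" where
  "dense_in_set A B \<longleftrightarrow> (top_of_set B) closure_of (A \<inter> B) = B"

definition eventually_dense :: "rat set \<Rightarrow> bool" where
  "eventually_dense M \<longleftrightarrow> (\<exists>r::real. r \<ge> 0 \<and> dense_in_set (of_rat ` M) {r<..})"

definition somewhere_dense :: "rat set \<Rightarrow> bool" where
  "somewhere_dense M \<longleftrightarrow>
     (\<exists>r s::real. {r<..<s} \<noteq> {} \<and> {r<..<s} \<subseteq> {0..} \<and> dense_in_set (of_rat ` M) {r<..<s})"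

end

(* For an open set S, density of A in S means that S lies in the closure of A.  The closure C of M
   is again a submonoid of the reals, so if (r, s) lies in C then so does (n r, n s) for every
   positive n.  Once x > r s / (s - r), some n satisfies n r < x < n s, so C contains every
   such x. *)

theory Submission
  imports Defs
begin

text \<open>A point of an open \<open>S\<close> that is a limit of points of \<open>A\<close> is
  already a limit of points of \<open>A\<close> inside \<open>S\<close>. So the intersection and the
  subspace topology can both be dropped.\<close>

lemma dense_in_set_open_iff:
  assumes "open S"
  shows "dense_in_set A S \<longleftrightarrow> S \<subseteq> closure A"
proof -
  have "S \<inter> closure (A \<inter> S) = S \<inter> closure A"
    using open_Int_closure_subset[OF assms, of A] closure_mono[of "A \<inter> S" A]
    by (auto simp: Int_commute)
  then show ?thesis
    by (auto simp: dense_in_set_def closure_of_subtopology Int_absorb1)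
qed

lemma closure_add_mem:
  fixes A :: "'a::real_normed_vector set"
  assumes "\<And>x y. x \<in> A \<Longrightarrow> y \<in> A \<Longrightarrow> x + y \<in> A"
    and "x \<in> closure A" "y \<in> closure A"
  shows "x + y \<in> closure A"
proof -
  obtain u v where "\<And>n. u n \<in> A" "u \<longlonglongrightarrow> x" "\<And>n. v n \<in> A" "v \<longlonglongrightarrow> y"
    using assms(2,3) unfolding closure_sequential by blast
  then have "\<And>n. u n + v n \<in> A" "(\<lambda>n. u n + v n) \<longlonglongrightarrow> x + y"
    using assms(1) by (auto intro: tendsto_add)
  then show ?thesis
    unfolding closure_sequential by (intro exI[of _ "\<lambda>n. u n + v n"]) auto
qed

lemma of_nat_mult_mem:
  fixes C :: "'a::semiring_1 set"
  assumes "0 \<in> C" "\<And>x y. x \<in> C \<Longrightarrow> y \<in> C \<Longrightarrow> x + y \<in> C" "y \<in> C"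
  shows "of_nat n * y \<in> C"
  by (induction n) (auto simp: assms distrib_right)

text \<open>The least \<open>n\<close> with \<open>x < n * s\<close> is at most
  \<open>x / s + 1\<close>, so \<open>n * r\<close> is at most \<open>(x / s + 1) * r\<close>. This
  bound is below \<open>x\<close> exactly when \<open>r * s < x * (s - r)\<close>.\<close>

lemma ex_nat_scale_between:
  fixes r s x :: real
  assumes "0 \<le> r" "r < s" "r * s / (s - r) < x"
  obtains n :: nat where "n > 0" "of_nat n * r < x" "x < of_nat n * s"
proof -
  have s: "0 < s" using assms by linarith
  have "0 \<le> r * s / (s - r)" using assms s by simp
  then have x: "0 < x" using assms(3) by linarith
  \<comment> \<open>The successor keeps \<open>x / s < n\<close> strict even when
    \<open>x / s\<close> is an integer, and it makes \<open>n\<close> positive.\<close>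
  define n where "n = Suc (nat \<lfloor>x / s\<rfloor>)"
  have n: "real n = of_int \<lfloor>x / s\<rfloor> + 1"
    using x s by (simp add: n_def)
  have "x / s < real n" unfolding n by linarith
  then have upper: "x < real n * s" using s by (simp add: field_simps)
  have "real n * r \<le> (x / s + 1) * r"
    unfolding n using assms(1) by (intro mult_right_mono) linarith+
  also have "\<dots> < x" using assms s by (simp add: field_simps)
  finally show thesis using upper by (intro that[of n]) (simp_all add: n_def)
qed

theorem proposition3p7:
  fixes M :: "rat set"
  assumes "puiseux_monoid M"
  shows "eventually_dense M \<longleftrightarrow> somewhere_dense M"
proof
  assume "eventually_dense M"
  then obtain r :: real where r: "r \<ge> 0" "{r<..} \<subseteq> closure (of_rat ` M)"
    by (auto simp: eventually_dense_def dense_in_set_open_iff)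
  show "somewhere_dense M"
    unfolding somewhere_dense_def
  proof (intro exI conjI)
    \<comment> \<open>Any nonempty bounded open interval inside the ray would serve; length 1 is
      arbitrary.\<close>
    show "{r<..<r + 1} \<noteq> {}" by simp
    show "{r<..<r + 1} \<subseteq> {0..}" using r(1) by auto
    show "dense_in_set (of_rat ` M) {r<..<r + 1}"
      using r(2) by (auto simp: dense_in_set_open_iff)
  qed
next
  define C :: "real set" where "C = closure (of_rat ` M)"
  assume "somewhere_dense M"
  then obtain r s :: real
    where rs: "r < s" "{r<..<s} \<subseteq> {0..}" and dense: "{r<..<s} \<subseteq> C"
    by (auto simp: somewhere_dense_def dense_in_set_open_iff C_def not_le)
  \<comment> \<open>The endpoint \<open>r\<close> is not in the open interval, but it is in its
    closure, and \<open>{0..}\<close> is closed.\<close>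
  have r: "0 \<le> r"
    using closure_mono[OF rs(2)] rs(1) by (simp add: closure_greaterThanLessThan)
  have "0 \<in> M" and sum_M: "\<And>x y. x \<in> M \<Longrightarrow> y \<in> M \<Longrightarrow> x + y \<in> M"
    using assms by (auto simp: puiseux_monoid_def)
  have zero: "0 \<in> C"
    unfolding C_def using \<open>0 \<in> M\<close> by (intro closure_subset[THEN subsetD]) force
  have add: "x + y \<in> C" if "x \<in> C" "y \<in> C" for x y
    using that unfolding C_def
    by (rule closure_add_mem[rotated]) (auto simp flip: of_rat_add intro: sum_M)
  have "x \<in> C" if x: "r * s / (s - r) < x" for x
  proof -
    obtain n :: nat where n: "n > 0" "n * r < x" "x < n * s"
      using ex_nat_scale_between[OF r rs(1) x] .
    \<comment> \<open>Dividing by \<open>n\<close> moves \<open>x\<close> into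
      \<open>(r, s)\<close>, where \<open>C\<close> contains everything; adding \<open>n\<close>
      copies of the quotient recovers \<open>x\<close>.\<close>
    then have "x / n \<in> C"
      by (intro dense[THEN subsetD]) (simp add: field_simps)
    then have "n * (x / n) \<in> C"
      by (intro of_nat_mult_mem zero add)
    then show ?thesis using n(1) by simp
  qed
  then have "dense_in_set (of_rat ` M) {r * s / (s - r)<..}"
    by (auto simp: dense_in_set_open_iff C_def)
  moreover have "0 \<le> r * s / (s - r)" using r rs(1) by simp
  ultimately show "eventually_dense M"
    unfolding eventually_dense_def by blast
qed

end
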